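(* Let $F,\phi:\mathcal X\to\mathbb R\cup\{+\infty\}$ be proper lower semicontinuous functions such that $\inf_{x\in\mathcal X}(F+\phi)(x)>-\infty$; $F$ is locally Lipschitz continuous at every point of $\operatorname{int}(\operatorname{dom}F)$; $\operatorname{dom}F$ is convex with $\operatorname{dom}\phi\subset\operatorname{int}(\operatorname{dom}F)$; and $\phi$ is prox-bounded with threshold $\gamma_\phi\in(0,+\infty]$. Assume moreover that $F$ is lower regular at every point of $\operatorname{int}(\operatorname{dom}F)$, that $\phi$ is prox-regular at every point of $\operatorname{dom}\phi$, and that the limiting subdifferential $\partial_{\rm L}\phi$ is outer semicontinuous at every point of $\operatorname{dom}\phi$. Choose $\widetilde\gamma\in(0,\gamma_\phi)$ arbitrarily. For $x^\star\in\operatorname{dom}\phi$, the following conditions are equivalent: (i) $x^\star$ is a Fréchet stationary point of $F+\phi$. (ii) There exist $(x_n)_{n=1}^\infty\subset\operatorname{int}(\operatorname{dom}F)$ with $\lim_{n\to\infty}x_n=x^\star$ and $(\gamma_n)_{n=1}^\infty\subset(0,\widetilde\gamma]$ such that $\liminf_{n\to\infty}\mathcal M_{\gamma_n}^{F,\phi}(x_n)=0$.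
   Context: $\mathcal X$ is a (finite-dimensional real) Euclidean space with inner product $\langle\cdot,\cdot\rangle$ and norm $\|\cdot\|$; $B(\bar x,\delta)$ is the open ball; $\operatorname{dom}\psi=\{x:\psi(x)<+\infty\}$; proper means $\operatorname{dom}\psi\neq\emptyset$. A function is locally Lipschitz continuous at $\bar x$ if it is Lipschitz continuous on some open neighborhood of $\bar x$. $\phi$ is prox-bounded with threshold $\gamma_\phi\in(0,+\infty]$ if $\phi+\frac1{2\gamma}\|\cdot\|^2$ is bounded below for all $\gamma\in(0,\gamma_\phi)$. Subdifferentials of $\psi:\mathcal X\to\mathbb R\cup\{+\infty\}$ at $\bar x\in\operatorname{dom}\psi$ (empty if $\bar x\notin\operatorname{dom}\psi$): - Fréchet: $v\in\partial_{\rm F}\psi(\bar x)$ if $\liminf_{x\to\bar x,\,x\ne\bar x}\frac{\psi(x)-\psi(\bar x)-\langle v,x-\bar x\rangle}{\|x-\bar x\|}\ge0$; - limiting: $v\in\partial_{\rm L}\psi(\bar x)$ if there are $x_n\to\bar x$ with $\psi(x_n)\to\psi(\bar x)$ and $v_n\in\partial_{\rm F}\psi(x_n)$ with $v_n\to v$. $x^\star\in\operatorname{dom}\phi$ is a Fréchet stationary point of $F+\phi$ if $0\in\partial_{\rm F}(F+\phi)(x^\star)$. $\psi$ is lower regular at $\bar x\in\operatorname{dom}\psi$ if $\partial_{\rm F}\psi(\bar x)=\partial_{\rm L}\psi(\bar x)$. $\psi$ is prox-regular at $\bar x\in\operatorname{dom}\psi$ for $\bar v\in\partial_{\rm L}\psi(\bar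 x)$ if there are $\delta>0$, $\eta\ge0$ such that $\psi(x')\ge\psi(x)+\langle v,x'-x\rangle-\frac\eta2\|x'-x\|^2$ for all $x'\in B(\bar x,\delta)$ whenever $x\in B(\bar x,\delta)$, $v\in\partial_{\rm L}\psi(x)\cap B(\bar v,\delta)$ and $\psi(x)<\psi(\bar x)+\delta$; $\psi$ is prox-regular at $\bar x$ if this holds for every $\bar v\in\partial_{\rm L}\psi(\bar x)$. For subsets $E_n\subset\mathcal X$, $\operatorname{Limsup}_{n\to\infty}E_n$ is the set of all $v$ that are limits of $(v_n)_{n\in N}$ with $v_n\in E_n$ along some infinite $N\subset\mathbb N$. A set-valued map $S:\mathcal X\rightrightarrows\mathcal X$ is outer semicontinuous at $\bar x$ if $\operatorname{Limsup}_{n\to\infty}S(x_n)\subset S(\bar x)$ for every sequence $x_n\to\bar x$ in $\mathcal X$. For $\gamma>0$, $\operatorname{prox}_{\gamma\phi}(\bar x)=\operatorname{argmin}_{x\in\mathcal X}\big(\phi(x)+\frac1{2\gamma}\|x-\bar x\|^2\big)$ (a set), and $$\mathcal M_\gamma^{F,\phi}(\bar x)=\inf\Big\{\Big\|\frac{\bar x-p}{\gamma}\Big\| : p\in\operatorname{prox}_{\gamma\phi}(\bar x-\gamma v),\ v\in\partial_{\rm L}F(\bar x)\Big\}\in[0,+\infty]\quad(\inf\emptyset=+\infty).$$ *)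

theory Defs
  imports "HOL-Analysis.Analysis"
begin

text \<open>
  Functions with values in the reals extended by \<open>+\<infinity>\<close> are functions into
  \<^typ>\<open>ereal\<close>; that the value \<open>-\<infinity>\<close> is not attained is part of \<open>proper_fun\<close>.
\<close>

definition edom :: "('a \<Rightarrow> ereal) \<Rightarrow> 'a set" where
  "edom \<psi> = {x. \<psi> x < \<infinity>}"

definition proper_fun :: "('a \<Rightarrow> ereal) \<Rightarrow> bool" where
  "proper_fun \<psi> \<longleftrightarrow> (\<forall>x. \<psi> x \<noteq> -\<infinity>) \<and> edom \<psi> \<noteq> {}"

definition lsc_fun :: "('a::topological_space \<Rightarrow> ereal) \<Rightarrow> bool" where
  "lsc_fun \<psi> \<longleftrightarrow> (\<forall>x. \<psi> x \<le> Liminf (at x) \<psi>)"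

text \<open>
  Since \<^const>\<open>real_of_ereal\<close> maps infinite values to \<open>0\<close>, finiteness on the
  neighbourhood has to be required separately.
\<close>

definition locally_lipschitz_at ::
    "('a::metric_space \<Rightarrow> ereal) \<Rightarrow> 'a \<Rightarrow> bool" where
  "locally_lipschitz_at \<psi> xbar \<longleftrightarrow>
     (\<exists>U L. open U \<and> xbar \<in> U \<and> (\<forall>x\<in>U. \<bar>\<psi> x\<bar> \<noteq> \<infinity>) \<and>
            lipschitz_on L U (\<lambda>x. real_of_ereal (\<psi> x)))"

text \<open>The threshold is not required to be maximal, and may be \<open>\<infinity>\<close>.\<close>

definition prox_bounded_with_threshold ::
    "('a::real_inner \<Rightarrow> ereal) \<Rightarrow> ereal \<Rightarrow> bool" where
  "prox_bounded_with_threshold \<phi> \<gamma>\<phi> \<longleftrightarrow> 0 < \<gamma>\<phi> \<and>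
     (\<forall>\<gamma>::real. 0 < \<gamma> \<and> ereal \<gamma> < \<gamma>\<phi> \<longrightarrow>
        (\<exists>c::real. \<forall>x. ereal c \<le> \<phi> x + ereal (1 / (2 * \<gamma>) * (norm x)\<^sup>2)))"

definition frechet_subdiff :: "('a::real_inner \<Rightarrow> ereal) \<Rightarrow> 'a \<Rightarrow> 'a set" where
  "frechet_subdiff \<psi> xbar = {v. xbar \<in> edom \<psi> \<and>
     0 \<le> Liminf (at xbar)
           (\<lambda>x. (\<psi> x - \<psi> xbar - ereal (v \<bullet> (x - xbar))) / ereal (norm (x - xbar)))}"

definition limiting_subdiff :: "('a::real_inner \<Rightarrow> ereal) \<Rightarrow> 'a \<Rightarrow> 'a set" where
  "limiting_subdiff \<psi> xbar = {v. xbar \<in> edom \<psi> \<and>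
     (\<exists>x w. x \<longlonglongrightarrow> xbar \<and> (\<lambda>n. \<psi> (x n)) \<longlonglongrightarrow> \<psi> xbar \<and>
            (\<forall>n::nat. w n \<in> frechet_subdiff \<psi> (x n)) \<and> w \<longlonglongrightarrow> v)}"

definition frechet_stationary ::
    "('a::real_inner \<Rightarrow> ereal) \<Rightarrow> ('a \<Rightarrow> ereal) \<Rightarrow> 'a \<Rightarrow> bool" where
  "frechet_stationary F \<phi> x \<longleftrightarrow>
     x \<in> edom \<phi> \<and> 0 \<in> frechet_subdiff (\<lambda>y. F y + \<phi> y) x"

definition lower_regular_at :: "('a::real_inner \<Rightarrow> ereal) \<Rightarrow> 'a \<Rightarrow> bool" where
  "lower_regular_at \<psi> xbar \<longleftrightarrow>
     xbar \<in> edom \<psi> \<and> frechet_subdiff \<psi> xbar = limiting_subdiff \<psi> xbar"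

definition prox_regular_at_for ::
    "('a::real_inner \<Rightarrow> ereal) \<Rightarrow> 'a \<Rightarrow> 'a \<Rightarrow> bool" where
  "prox_regular_at_for \<psi> xbar vbar \<longleftrightarrow>
     xbar \<in> edom \<psi> \<and> vbar \<in> limiting_subdiff \<psi> xbar \<and>
     (\<exists>\<delta>>0. \<exists>\<eta>\<ge>0. \<forall>x \<in> ball xbar \<delta>. \<forall>v \<in> limiting_subdiff \<psi> x \<inter> ball vbar \<delta>.
        \<psi> x < \<psi> xbar + ereal \<delta> \<longrightarrow>
        (\<forall>x' \<in> ball xbar \<delta>.
           \<psi> x + ereal (v \<bullet> (x' - x) - \<eta> / 2 * (norm (x' - x))\<^sup>2) \<le> \<psi> x'))"

definition prox_regular_at :: "('a::real_inner \<Rightarrow> ereal) \<Rightarrow> 'a \<Rightarrow> bool" where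
  "prox_regular_at \<psi> xbar \<longleftrightarrow>
     xbar \<in> edom \<psi> \<and> (\<forall>vbar \<in> limiting_subdiff \<psi> xbar. prox_regular_at_for \<psi> xbar vbar)"

text \<open>
  The outer limit (upper Kuratowski limit) of a sequence of sets; an infinite index set
  is given by its increasing enumeration \<open>r\<close>.
\<close>

definition set_Limsup :: "(nat \<Rightarrow> 'a::topological_space set) \<Rightarrow> 'a set" where
  "set_Limsup E = {v. \<exists>(r::nat \<Rightarrow> nat) w. strict_mono r \<and> (\<forall>k. w k \<in> E (r k)) \<and> w \<longlonglongrightarrow> v}"

definition outer_semicontinuous_at ::
    "('a::topological_space \<Rightarrow> 'b::topological_space set) \<Rightarrow> 'a \<Rightarrow> bool" where
  "outer_semicontinuous_at S xbar \<longleftrightarrow>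
     (\<forall>x. x \<longlonglongrightarrow> xbar \<longrightarrow> set_Limsup (\<lambda>n. S (x n)) \<subseteq> S xbar)"

definition prox :: "real \<Rightarrow> ('a::real_inner \<Rightarrow> ereal) \<Rightarrow> 'a \<Rightarrow> 'a set" where
  "prox \<gamma> \<phi> xbar =
     {p. is_arg_min (\<lambda>x. \<phi> x + ereal (1 / (2 * \<gamma>) * (norm (x - xbar))\<^sup>2)) (\<lambda>_. True) p}"

text \<open>In \<^typ>\<open>ereal\<close> the infimum of the empty set is \<open>\<infinity>\<close>.\<close>

definition residual_measure ::
    "real \<Rightarrow> ('a::real_inner \<Rightarrow> ereal) \<Rightarrow> ('a \<Rightarrow> ereal) \<Rightarrow> 'a \<Rightarrow> ereal" where
  "residual_measure \<gamma> F \<phi> xbar =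
     Inf {ereal (norm ((xbar - p) /\<^sub>R \<gamma>)) | p v.
            v \<in> limiting_subdiff F xbar \<and> p \<in> prox \<gamma> \<phi> (xbar - \<gamma> *\<^sub>R v)}"

end

theory Submission
  imports Defs
begin

text \<open>
  If \<open>xstar\<close> is stationary, a fuzzy sum rule and outer semicontinuity give \<open>u\<close> in the limiting
  subdifferential of \<open>F\<close> with \<open>- u\<close> in that of \<open>\<phi>\<close>; prox-regularity and prox-boundedness then
  make \<open>xstar\<close> a prox point of \<open>xstar - \<gamma> u\<close> for small \<open>\<gamma>\<close>, so constant sequences suffice.
  Conversely, optimality of the prox points \<open>p\<close> puts \<open>(x - p) / \<gamma> - v\<close> in the subdifferential of
  \<open>\<phi>\<close> at \<open>p\<close>; subgradients of \<open>F\<close> are bounded near \<open>xstar\<close>, so a subsequence yields a limit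
  \<open>l\<close>, and lower regularity of \<open>F\<close> and prox-regularity of \<open>\<phi>\<close> turn \<open>l\<close> and \<open>- l\<close> into Frechet
  subgradients, whose sum is \<open>0\<close>.
\<close>

section \<open>Frechet subgradients and optimality of proximal points\<close>

text \<open>The quotient in \<open>ereal\<close> disappears on multiplication by the positive
  \<open>norm (y - x)\<close>. At \<open>y = x\<close> the weak inequality is trivial, so a full
  ball can replace the punctured neighbourhood.\<close>

lemma frechet_subdiff_iff:
  fixes \<psi> :: "'a::real_inner \<Rightarrow> ereal"
  assumes "\<psi> x = ereal a"
  shows "v \<in> frechet_subdiff \<psi> x \<longleftrightarrow>
    (\<forall>e>0. \<exists>d>0. \<forall>y \<in> ball x d. ereal (a + v \<bullet> (y - x) - e * norm (y - x)) \<le> \<psi> y)"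
    (is "?L \<longleftrightarrow> ?R")
proof -
  let ?q = "\<lambda>y. (\<psi> y - \<psi> x - ereal (v \<bullet> (y - x))) / ereal (norm (y - x))"
  have q_less: "ereal (- e) < ?q y \<longleftrightarrow> ereal (a + v \<bullet> (y - x) - e * norm (y - x)) < \<psi> y"
    if "y \<noteq> x" for y e
  proof -
    have "norm (y - x) > 0" using that by simp
    then show ?thesis
      using assms by (cases "\<psi> y") (simp_all add: pos_less_divide_eq, linarith)
  qed
  have "x \<in> edom \<psi>" using assms by (simp add: edom_def)
  then have "?L \<longleftrightarrow> (\<forall>c<0. \<forall>\<^sub>F y in at x. c < ?q y)"
    unfolding frechet_subdiff_def by (simp add: le_Liminf_iff)
  also have "\<dots> \<longleftrightarrow> (\<forall>e>0. \<forall>\<^sub>F y in at x. ereal (- e) < ?q y)"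
  proof safe
    fix c :: ereal assume *: "\<forall>e>0. \<forall>\<^sub>F y in at x. ereal (- e) < ?q y" and "c < 0"
    \<comment> \<open>As \<open>c\<close> may be \<open>-\<infinity>\<close>, a real number between
      \<open>c\<close> and \<open>0\<close> supplies the real error \<open>e = - r\<close>.\<close>
    then obtain r where "c < ereal r" "ereal r < 0" using ereal_dense2 by blast
    then have "- r > 0" by simp
    with * have "\<forall>\<^sub>F y in at x. ereal (- (- r)) < ?q y" by blast
    then show "\<forall>\<^sub>F y in at x. c < ?q y"
      using \<open>c < ereal r\<close> by (auto elim!: eventually_mono intro: less_trans)
  qed auto
  also have "\<dots> \<longleftrightarrow> (\<forall>e>0. \<forall>\<^sub>F y in at x. ereal (a + v \<bullet> (y - x) - e * norm (y - x)) < \<psi> y)"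
    unfolding eventually_at_filter using q_less by (simp cong: imp_cong)
  also have "\<dots> \<longleftrightarrow> ?R"
  proof
    assume *: "\<forall>e>0. \<forall>\<^sub>F y in at x. ereal (a + v \<bullet> (y - x) - e * norm (y - x)) < \<psi> y"
    show ?R
    proof (intro allI impI)
      fix e :: real assume "e > 0"
      with * obtain d where d: "d > 0"
        "\<forall>y. y \<noteq> x \<and> dist y x < d \<longrightarrow> ereal (a + v \<bullet> (y - x) - e * norm (y - x)) < \<psi> y"
        unfolding eventually_at by blast
      then have "ereal (a + v \<bullet> (y - x) - e * norm (y - x)) \<le> \<psi> y" if "y \<in> ball x d" for y
        using assms that by (cases "y = x") (auto simp: dist_commute less_imp_le)
      with d(1) show "\<exists>d>0. \<forall>y\<in>ball x d. ereal (a + v \<bullet> (y - x) - e * norm (y - x)) \<le> \<psi> y" by blast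
    qed
  next
    assume R: ?R
    show "\<forall>e>0. \<forall>\<^sub>F y in at x. ereal (a + v \<bullet> (y - x) - e * norm (y - x)) < \<psi> y"
    proof (intro allI impI)
      fix e :: real assume "e > 0"
      \<comment> \<open>Off the centre, the weak inequality for \<open>e/2\<close> is a strict one
        for \<open>e\<close>.\<close>
      then obtain d where d: "d > 0"
        "\<forall>y\<in>ball x d. ereal (a + v \<bullet> (y - x) - (e/2) * norm (y - x)) \<le> \<psi> y"
        using R half_gt_zero by blast
      have "ereal (a + v \<bullet> (y - x) - e * norm (y - x)) < \<psi> y" if "y \<noteq> x" "dist y x < d" for y
      proof -
        have "e * norm (y - x) > 0" using that \<open>e > 0\<close> by simp
        then have "ereal (a + v \<bullet> (y - x) - e * norm (y - x))
            < ereal (a + v \<bullet> (y - x) - (e/2) * norm (y - x))" by simp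
        also have "\<dots> \<le> \<psi> y" using d that by (simp add: dist_commute)
        finally show ?thesis .
      qed
      then show "\<forall>\<^sub>F y in at x. ereal (a + v \<bullet> (y - x) - e * norm (y - x)) < \<psi> y"
        unfolding eventually_at using d(1) by blast
    qed
  qed
  finally show ?thesis .
qed

text \<open>A quadratic error is of higher order than the permitted linear one:
  \<open>c * norm (y - x) \<le> e\<close> once \<open>norm (y - x)\<close> is at most
  \<open>e / (\<bar>c\<bar> + 1)\<close>, where the added 1 covers \<open>c = 0\<close>.\<close>

lemma frechet_subdiff_quadraticI:
  fixes \<psi> :: "'a::real_inner \<Rightarrow> ereal"
  assumes "\<psi> x = ereal a" "d > 0"
    and "\<And>y. y \<in> ball x d \<Longrightarrow> ereal (a + v \<bullet> (y - x) - c * (norm (y - x))\<^sup>2) \<le> \<psi> y"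
  shows "v \<in> frechet_subdiff \<psi> x"
  unfolding frechet_subdiff_iff[of \<psi>, OF assms(1)]
proof (intro allI impI)
  fix e :: real assume "e > 0"
  define r where "r = min d (e / (\<bar>c\<bar> + 1))"
  have "ereal (a + v \<bullet> (y - x) - e * norm (y - x)) \<le> \<psi> y" if "y \<in> ball x r" for y
  proof -
    have n: "norm (y - x) < d" "norm (y - x) \<le> e / (\<bar>c\<bar> + 1)"
      using that by (auto simp: r_def dist_norm norm_minus_commute)
    have "c * norm (y - x) \<le> (\<bar>c\<bar> + 1) * norm (y - x)"
      by (intro mult_right_mono) auto
    also have "\<dots> \<le> e" using n(2) by (simp add: field_simps)
    finally have "c * (norm (y - x))\<^sup>2 \<le> e * norm (y - x)"
      unfolding power2_eq_square mult.assoc[symmetric] by (intro mult_right_mono) auto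
    then have "ereal (a + v \<bullet> (y - x) - e * norm (y - x))
        \<le> ereal (a + v \<bullet> (y - x) - c * (norm (y - x))\<^sup>2)" by simp
    also have "\<dots> \<le> \<psi> y"
      using n(1) by (intro assms(3)) (simp add: dist_norm norm_minus_commute)
    finally show ?thesis .
  qed
  moreover have "r > 0" using assms(2) \<open>e > 0\<close> by (simp add: r_def add_nonneg_pos)
  ultimately show "\<exists>r>0. \<forall>y\<in>ball x r. ereal (a + v \<bullet> (y - x) - e * norm (y - x)) \<le> \<psi> y"
    by blast
qed

lemma frechet_subdiff_add:
  fixes \<psi> \<theta> :: "'a::real_inner \<Rightarrow> ereal"
  assumes "\<psi> x = ereal a" "\<theta> x = ereal b"
    and "v \<in> frechet_subdiff \<psi> x" "w \<in> frechet_subdiff \<theta> x"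
  shows "v + w \<in> frechet_subdiff (\<lambda>y. \<psi> y + \<theta> y) x"
proof -
  have ab: "\<psi> x + \<theta> x = ereal (a + b)" using assms by simp
  show ?thesis
    unfolding frechet_subdiff_iff[of "\<lambda>y. \<psi> y + \<theta> y", OF ab]
  proof (intro allI impI)
    fix e :: real assume "e > 0"
    then have "e / 2 > 0" by simp
    obtain d1 where "d1 > 0"
      and d1: "\<And>y. y \<in> ball x d1 \<Longrightarrow> ereal (a + v \<bullet> (y - x) - e/2 * norm (y - x)) \<le> \<psi> y"
      using assms(3) \<open>e / 2 > 0\<close> unfolding frechet_subdiff_iff[of \<psi>, OF assms(1)] by blast
    obtain d2 where "d2 > 0"
      and d2: "\<And>y. y \<in> ball x d2 \<Longrightarrow> ereal (b + w \<bullet> (y - x) - e/2 * norm (y - x)) \<le> \<theta> y"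
      using assms(4) \<open>e / 2 > 0\<close> unfolding frechet_subdiff_iff[of \<theta>, OF assms(2)] by blast
    have "ereal (a + b + (v + w) \<bullet> (y - x) - e * norm (y - x)) \<le> \<psi> y + \<theta> y"
      if "y \<in> ball x (min d1 d2)" for y
    proof -
      have "ereal (a + b + (v + w) \<bullet> (y - x) - e * norm (y - x))
          = ereal (a + v \<bullet> (y - x) - e/2 * norm (y - x)) + ereal (b + w \<bullet> (y - x) - e/2 * norm (y - x))"
        by (simp add: inner_add_left)
      also have "\<dots> \<le> \<psi> y + \<theta> y" using that by (intro add_mono d1 d2) auto
      finally show ?thesis .
    qed
    then show "\<exists>d>0. \<forall>y\<in>ball x d. ereal (a + b + (v + w) \<bullet> (y - x) - e * norm (y - x)) \<le> \<psi> y + \<theta> y"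
      using \<open>d1 > 0\<close> \<open>d2 > 0\<close> by (intro exI[of _ "min d1 d2"]) auto
  qed
qed

lemma frechet_subset_limiting: "frechet_subdiff \<psi> x \<subseteq> limiting_subdiff \<psi> x"
proof
  fix v assume "v \<in> frechet_subdiff \<psi> x"
  then show "v \<in> limiting_subdiff \<psi> x"
    unfolding limiting_subdiff_def mem_Collect_eq
    by (intro conjI exI[of _ "\<lambda>_. x"] exI[of _ "\<lambda>_. v"]) (auto simp: frechet_subdiff_def)
qed

text \<open>A short move from \<open>x\<close> along \<open>v\<close> itself raises
  \<open>\<psi>\<close> by at least \<open>norm v - e\<close> per unit length, while the Lipschitz
  condition permits at most \<open>L\<close>; then \<open>e\<close> tends to 0.\<close>

lemma frechet_subdiff_lipschitz_bound:
  fixes \<psi> :: "'a::real_inner \<Rightarrow> ereal"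
  assumes "open U" "x \<in> U" and fin: "\<forall>y\<in>U. \<bar>\<psi> y\<bar> \<noteq> \<infinity>"
    and lip: "L-lipschitz_on U (\<lambda>y. real_of_ereal (\<psi> y))"
    and v: "v \<in> frechet_subdiff \<psi> x"
  shows "norm v \<le> L"
proof (rule field_le_epsilon)
  fix e :: real assume e: "e > 0"
  define f where "f = (\<lambda>y. real_of_ereal (\<psi> y))"
  have f: "\<psi> y = ereal (f y)" if "y \<in> U" for y using fin that by (simp add: f_def ereal_real)
  obtain d0 where d0: "d0 > 0" "ball x d0 \<subseteq> U" using assms(1,2) open_contains_ball by blast
  obtain d where d: "d > 0"
    "\<And>y. y \<in> ball x d \<Longrightarrow> ereal (f x + v \<bullet> (y - x) - e * norm (y - x)) \<le> \<psi> y"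
    using v e unfolding frechet_subdiff_iff[of \<psi>, OF f[OF \<open>x \<in> U\<close>]] by meson
  show "norm v \<le> L + e"
  proof (cases "v = 0")
    case True
    then show ?thesis using lipschitz_on_nonneg[OF lip] e by simp
  next
    case False
    \<comment> \<open>The step \<open>s *\<^sub>R v\<close> has length \<open>min d d0 / 2\<close>,
      so the test point lies in both balls.\<close>
    define s where "s = min d d0 / 2 / norm v"
    have s: "s > 0" using d d0 False by (simp add: s_def)
    define y where "y = x + s *\<^sub>R v"
    have ny: "norm (y - x) = s * norm v" using s by (simp add: y_def)
    also have "\<dots> = min d d0 / 2" using False by (simp add: s_def)
    finally have "y \<in> ball x d" "y \<in> ball x d0"
      using d(1) d0(1) by (auto simp: dist_norm norm_minus_commute)
    then have "f x + v \<bullet> (y - x) - e * norm (y - x) \<le> f y"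
      using d(2)[of y] f[of y] d0 by auto
    also have "f y \<le> f x + L * norm (y - x)"
      using lipschitz_onD[OF lip, of y x] \<open>y \<in> ball x d0\<close> d0 \<open>x \<in> U\<close>
      by (auto simp: dist_norm f_def)
    finally have "v \<bullet> (y - x) \<le> (L + e) * (s * norm v)" by (simp add: ny algebra_simps)
    moreover have "v \<bullet> (y - x) = norm v * (s * norm v)"
      by (simp add: y_def power2_norm_eq_inner[symmetric] power2_eq_square)
    ultimately show ?thesis using s False by (simp add: mult_le_cancel_right)
  qed
qed

text \<open>Expanding the square about \<open>p\<close> turns minimality into a quadratic minorant
  of \<open>\<phi>\<close> with slope \<open>(z - p) /\<^sub>R \<gamma>\<close> at \<open>p\<close>.
  The minorant is global, so the radius 1 in the proof is arbitrary.\<close>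

lemma prox_optimality:
  fixes \<phi> :: "'a::real_inner \<Rightarrow> ereal"
  assumes "proper_fun \<phi>" "\<gamma> > 0" "p \<in> prox \<gamma> \<phi> z"
  shows "(z - p) /\<^sub>R \<gamma> \<in> frechet_subdiff \<phi> p"
proof -
  have min: "\<phi> p + ereal (1 / (2 * \<gamma>) * (norm (p - z))\<^sup>2) \<le> \<phi> y + ereal (1 / (2 * \<gamma>) * (norm (y - z))\<^sup>2)" for y
    using assms(3) by (auto simp: prox_def is_arg_min_def not_less)
  obtain y0 where "\<phi> y0 < \<infinity>" using assms(1) by (auto simp: proper_fun_def edom_def)
  then have "\<phi> p \<noteq> \<infinity>" using min[of y0] by auto
  moreover have "\<phi> p \<noteq> -\<infinity>" using assms(1) by (simp add: proper_fun_def)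
  ultimately obtain a where a: "\<phi> p = ereal a" by (cases "\<phi> p") auto
  show ?thesis
  proof (rule frechet_subdiff_quadraticI[of \<phi>, OF a zero_less_one, where c = "1 / (2 * \<gamma>)"])
    fix y
    have id: "(norm (y - z))\<^sup>2 = (norm (y - p))\<^sup>2 + (norm (p - z))\<^sup>2 - 2 * ((z - p) \<bullet> (y - p))"
      by (simp add: power2_norm_eq_inner inner_diff inner_commute)
    show "ereal (a + ((z - p) /\<^sub>R \<gamma>) \<bullet> (y - p) - 1 / (2 * \<gamma>) * (norm (y - p))\<^sup>2) \<le> \<phi> y"
    proof (cases "\<phi> y")
      case (real b)
      have "a + 1 / (2 * \<gamma>) * (norm (p - z))\<^sup>2 \<le> b + 1 / (2 * \<gamma>) * (norm (y - z))\<^sup>2"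
        using min[of y] a real by simp
      moreover have "((z - p) /\<^sub>R \<gamma>) \<bullet> (y - p) = 1 / (2 * \<gamma>) * (2 * ((z - p) \<bullet> (y - p)))"
        using assms(2) by (simp add: divide_simps)
      moreover define k where "k = 1 / (2 * \<gamma>)"
      ultimately show ?thesis unfolding id real k_def[symmetric]
        by (simp add: algebra_simps)
    next
      case MInf
      then show ?thesis using assms(1) by (simp add: proper_fun_def)
    qed simp
  qed
qed

section \<open>Attainment of minima and sum rules\<close>

lemma lsc_fun_sequentially:
  assumes "lsc_fun \<psi>" "s \<longlonglongrightarrow> x"
  shows "\<psi> x \<le> liminf (\<lambda>n. \<psi> (s n))"
  unfolding le_Liminf_iff
proof (intro allI impI)
  fix c assume c: "c < \<psi> x"
  then have "\<forall>\<^sub>F y in at x. c < \<psi> y"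
    using assms(1) by (auto simp: lsc_fun_def le_Liminf_iff)
  \<comment> \<open>\<open>Liminf (at x)\<close> leaves out \<open>x\<close>, which the sequence may
    hit; there the bound is \<open>c < \<psi> x\<close>.\<close>
  with c have "\<forall>\<^sub>F y in nhds x. c < \<psi> y"
    by (auto simp: eventually_at_filter elim: eventually_mono)
  then show "\<forall>\<^sub>F n in sequentially. c < \<psi> (s n)"
    using assms(2) by (auto simp: filterlim_iff)
qed

text \<open>A convergent subsequence of a minimizing sequence has a minimizer as its limit.
  Semicontinuity is asked only along sequences in \<open>K\<close>, since in the application the
  real-valued part is known to be continuous only there.\<close>

lemma compact_attains_inf_lsc:
  fixes f :: "'a::metric_space \<Rightarrow> ereal"
  assumes "compact K" "K \<noteq> {}"
    and lsc: "\<And>s x. (\<And>n. s n \<in> K) \<Longrightarrow> x \<in> K \<Longrightarrow> s \<longlonglongrightarrow> x \<Longrightarrow> f x \<le> liminf (\<lambda>n. f (s n))"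
  obtains x where "x \<in> K" "\<And>y. y \<in> K \<Longrightarrow> f x \<le> f y"
proof -
  obtain u where u: "\<And>n. u n \<in> f ` K" "u \<longlonglongrightarrow> Inf (f ` K)"
    using Inf_as_limit[of "f ` K"] assms(2) by auto
  then have "\<forall>n. \<exists>x. x \<in> K \<and> u n = f x" by blast
  then obtain s where s: "\<And>n. s n \<in> K" "\<And>n. u n = f (s n)" by metis
  obtain x r where x: "x \<in> K" "strict_mono r" "(s \<circ> r) \<longlonglongrightarrow> x"
    using assms(1) s(1) unfolding compact_def by blast
  have "(\<lambda>n. f ((s \<circ> r) n)) \<longlonglongrightarrow> Inf (f ` K)"
    using LIMSEQ_subseq_LIMSEQ[OF u(2) x(2)] s(2) by (simp add: o_def)
  moreover have "f x \<le> liminf (\<lambda>n. f ((s \<circ> r) n))"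
    using x s(1) by (intro lsc) (auto simp: o_def)
  ultimately have "f x \<le> Inf (f ` K)"
    using lim_imp_Liminf[OF sequentially_bot] by metis
  then show thesis using that x(1) by (meson INF_lower order_trans)
qed

text \<open>
  Doubling of variables: the Frechet inequality makes \<open>x\<close> a strict minimizer over the
  \<open>\<rho>\<close>-ball once the smooth term \<open>(2 \<epsilon> / \<rho>) (norm (y - x))\<^sup>2\<close> is added, since that term beats the
  error \<open>\<epsilon> norm (y - x)\<close> on the boundary. Decoupling the two summands by the penalty
  \<open>k (norm (y - z))\<^sup>2\<close> keeps the minimizer interior because \<open>F\<close> is Lipschitz.
\<close>

lemma fuzzy_sum_rule:
  fixes F \<phi> :: "'a::euclidean_space \<Rightarrow> ereal"
  assumes lsc: "lsc_fun \<phi>" and noninf: "\<And>y. \<phi> y \<noteq> -\<infinity>" and dom: "x \<in> edom \<phi>"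
    and F: "locally_lipschitz_at F x"
    and v: "v \<in> frechet_subdiff (\<lambda>y. F y + \<phi> y) x" and "e > 0"
  obtains z y u w where "u \<in> frechet_subdiff F z" "w \<in> frechet_subdiff \<phi> y"
    "dist x z < e" "dist x y < e" "norm (u + w - v) < e"
proof -
  obtain U L where U: "open U" "x \<in> U" and fin: "\<forall>y\<in>U. \<bar>F y\<bar> \<noteq> \<infinity>"
    and lip: "L-lipschitz_on U (\<lambda>y. real_of_ereal (F y))"
    using F unfolding locally_lipschitz_at_def by blast
  define f where "f = (\<lambda>y. real_of_ereal (F y))"
  have f: "F y = ereal (f y)" if "y \<in> U" for y using fin that by (simp add: f_def ereal_real)
  have L: "L \<ge> 0" using lipschitz_on_nonneg[OF lip] .
  have fL: "f y - f z \<le> L * norm (z - y)" if "y \<in> U" "z \<in> U" for y z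
    using lipschitz_onD[OF lip that] by (simp add: f_def dist_norm norm_minus_commute)
  have fcont: "continuous_on U f"
    unfolding f_def by (rule lipschitz_on_continuous_on[OF lip])
  obtain a where a: "\<phi> x = ereal a" using dom noninf[of x] by (cases "\<phi> x") (auto simp: edom_def)
  have fa: "F x + \<phi> x = ereal (f x + a)" using f[OF \<open>x \<in> U\<close>] a by simp

  \<comment> \<open>In the end \<open>norm (u + w - v)\<close> is at most
    \<open>4 * \<epsilon>\<close>, which is half of \<open>e\<close>.\<close>
  define \<epsilon> where "\<epsilon> = e / 8"
  have "\<epsilon> > 0" using \<open>e > 0\<close> by (simp add: \<epsilon>_def)
  obtain d0 where d0: "d0 > 0" "ball x d0 \<subseteq> U" using U open_contains_ball by blast
  obtain d1 where d1: "d1 > 0"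
    "\<And>y. y \<in> ball x d1 \<Longrightarrow> ereal (f x + a + v \<bullet> (y - x) - \<epsilon> * norm (y - x)) \<le> F y + \<phi> y"
    using v \<open>\<epsilon> > 0\<close> unfolding frechet_subdiff_iff[of "\<lambda>y. F y + \<phi> y", OF fa] by blast
  define \<rho> where "\<rho> = min e (min d0 d1) / 3"
  have \<rho>: "\<rho> > 0" "2 * \<rho> < e" "2 * \<rho> < d0" "2 * \<rho> < d1"
    using \<open>e > 0\<close> d0(1) d1(1) by (auto simp: \<rho>_def)
  \<comment> \<open>The summands of \<open>k\<close> serve the two interiority claims:
    \<open>A\<close> gives \<open>k * \<rho> > L + \<epsilon>\<close> and so
    \<open>t < \<rho>\<close>; \<open>B\<close> pushes the maximum
    \<open>L\<^sup>2 / (4 * k)\<close> of \<open>L * t - k * t\<^sup>2\<close> below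
    \<open>\<epsilon> * \<rho>\<close> and so gives \<open>r < \<rho>\<close>.\<close>
  define A B where "A = (L + \<epsilon>) / \<rho>" and "B = L\<^sup>2 / (4 * (\<epsilon> * \<rho>))"
  define k where "k = A + B + 1"
  have A: "A \<ge> 0" "A * \<rho> = L + \<epsilon>" using L \<open>\<epsilon> > 0\<close> \<rho>(1) by (simp_all add: A_def)
  have \<epsilon>\<rho>: "\<epsilon> * \<rho> > 0" using \<open>\<epsilon> > 0\<close> \<rho>(1) by simp
  have B: "B \<ge> 0" "B * (4 * (\<epsilon> * \<rho>)) = L\<^sup>2"
    unfolding B_def using \<open>\<epsilon> > 0\<close> \<rho>(1) by simp_all
  have kpos: "k > 0" using A(1) B(1) by (simp add: k_def)
  have k1: "k * \<rho> > L + \<epsilon>"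
  proof -
    have "k * \<rho> = A * \<rho> + B * \<rho> + \<rho>" by (simp add: k_def distrib_right)
    then show ?thesis using A(2) mult_nonneg_nonneg[OF B(1)] \<rho>(1) by (smt (verit))
  qed
  have k2: "4 * k * (\<epsilon> * \<rho>) > L\<^sup>2"
  proof -
    have "4 * k * (\<epsilon> * \<rho>) = 4 * (A * (\<epsilon> * \<rho>)) + B * (4 * (\<epsilon> * \<rho>)) + 4 * (\<epsilon> * \<rho>)"
      by (simp add: k_def distrib_right distrib_left)
    moreover have "A * (\<epsilon> * \<rho>) \<ge> 0" using A(1) \<epsilon>\<rho> by simp
    ultimately show ?thesis using B(2) \<epsilon>\<rho> by linarith
  qed

  define h where "h = (\<lambda>(z, y). f z - v \<bullet> (y - x) + 2 * \<epsilon> / \<rho> * (norm (y - x))\<^sup>2 + k * (norm (z - y))\<^sup>2)"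
  define \<Psi> where "\<Psi> = (\<lambda>p. ereal (h p) + \<phi> (snd p))"
  \<comment> \<open>The double radius for \<open>z\<close> is needed because \<open>z\<close> is
    controlled only through \<open>y\<close>: from \<open>r < \<rho>\<close> and
    \<open>t < \<rho>\<close> follows \<open>dist x z < 2 * \<rho>\<close>.\<close>
  define K where "K = cball x (2 * \<rho>) \<times> cball x \<rho>"
  have KU: "cball x (2 * \<rho>) \<subseteq> U" using d0 \<rho> by auto
  have hcont: "continuous_on K h"
    unfolding h_def K_def case_prod_beta
    by (intro continuous_intros continuous_on_compose2[OF fcont]) (use KU in auto)
  have "compact K" unfolding K_def by (intro compact_Times) auto
  moreover have xK: "(x, x) \<in> K" using \<rho> by (simp add: K_def)
  moreover have "\<Psi> p \<le> liminf (\<lambda>n. \<Psi> (s n))" if s: "\<And>n. s n \<in> K" "p \<in> K" "s \<longlonglongrightarrow> p" for s p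
  proof -
    have "(\<lambda>n. h (s n)) \<longlonglongrightarrow> h p"
      using continuous_on_tendsto_compose[OF hcont s(3,2)] s(1) by simp
    then have "(\<lambda>n. ereal (h (s n))) \<longlonglongrightarrow> ereal (h p)" by simp
    then have "liminf (\<lambda>n. \<Psi> (s n)) = ereal (h p) + liminf (\<lambda>n. \<phi> (snd (s n)))"
      unfolding \<Psi>_def by (intro ereal_liminf_lim_add) auto
    moreover have "\<phi> (snd p) \<le> liminf (\<lambda>n. \<phi> (snd (s n)))"
      using s(3) by (intro lsc_fun_sequentially[OF lsc] tendsto_intros)
    ultimately show ?thesis by (simp add: \<Psi>_def add_left_mono)
  qed
  ultimately obtain p where p: "p \<in> K" "\<And>q. q \<in> K \<Longrightarrow> \<Psi> p \<le> \<Psi> q"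
    using compact_attains_inf_lsc[of K \<Psi>] by blast
  obtain z y where zy: "p = (z, y)" by (cases p)
  have z: "z \<in> cball x (2 * \<rho>)" and y: "y \<in> cball x \<rho>" using p(1) by (auto simp: K_def zy)
  have yU: "y \<in> U" and zU: "z \<in> U" using z y KU \<rho> by auto
  have "\<Psi> (z, y) \<le> \<Psi> (x, x)" using p(2)[OF xK] by (simp add: zy)
  then have le: "ereal (h (z, y)) + \<phi> y \<le> ereal (f x + a)"
    by (simp add: \<Psi>_def a h_def)
  then obtain b where b: "\<phi> y = ereal b" using noninf[of y] by (cases "\<phi> y") auto
  define r t where "r = norm (y - x)" and "t = norm (z - y)"
  have rt: "r \<ge> 0" "t \<ge> 0" "r \<le> \<rho>"
    using y by (auto simp: r_def t_def dist_norm norm_minus_commute)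
  \<comment> \<open>Three inequalities are added: minimality against \<open>(x, x)\<close>, the
    Frechet inequality at \<open>y\<close>, and the Lipschitz bound between \<open>y\<close> and
    \<open>z\<close>. All function values and the terms in \<open>v\<close> cancel.\<close>
  have "f z - v \<bullet> (y - x) + 2 * \<epsilon> / \<rho> * r\<^sup>2 + k * t\<^sup>2 + b \<le> f x + a"
    using le b by (simp add: h_def r_def t_def)
  moreover have "f x + a + v \<bullet> (y - x) - \<epsilon> * r \<le> f y + b"
    using d1(2)[of y] y \<rho> f[OF yU] b by (simp add: r_def)
  moreover have "f y - f z \<le> L * t" using fL[OF yU zU] by (simp add: t_def)
  ultimately have key: "2 * \<epsilon> / \<rho> * r\<^sup>2 - \<epsilon> * r + (k * t\<^sup>2 - L * t) \<le> 0" by linarith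
  have "t < \<rho>"
  proof (rule ccontr)
    assume "\<not> t < \<rho>"
    then have "k * t \<ge> k * \<rho>" using kpos by simp
    then have "k * t - L > \<epsilon>" using k1 by linarith
    then have "(k * t - L) * t > \<epsilon> * \<rho>"
      using \<open>\<not> t < \<rho>\<close> \<open>\<epsilon> > 0\<close> \<rho>(1) by (intro mult_less_le_imp_less) auto
    then have "k * t\<^sup>2 - L * t > \<epsilon> * \<rho>" by (simp add: power2_eq_square algebra_simps)
    moreover have "\<epsilon> * r \<le> \<epsilon> * \<rho>" using rt \<open>\<epsilon> > 0\<close> by simp
    moreover have "2 * \<epsilon> / \<rho> * r\<^sup>2 \<ge> 0" using \<open>\<epsilon> > 0\<close> \<rho>(1) by simp
    ultimately show False using key by linarith
  qed
  have "r < \<rho>"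
  proof (rule ccontr)
    assume "\<not> r < \<rho>"
    then have "r = \<rho>" using rt by simp
    \<comment> \<open>On the boundary the quadratic term exceeds the linear error by exactly
      \<open>\<epsilon> * \<rho>\<close>; completing the square shows that
      \<open>L * t - k * t\<^sup>2\<close> cannot reach this.\<close>
    then have "2 * \<epsilon> / \<rho> * r\<^sup>2 - \<epsilon> * r = \<epsilon> * \<rho>" using \<rho>(1) by (simp add: power2_eq_square)
    with key have "\<epsilon> * \<rho> \<le> L * t - k * t\<^sup>2" by linarith
    then have "4 * k * (\<epsilon> * \<rho>) \<le> 4 * k * (L * t - k * t\<^sup>2)" using kpos by (intro mult_left_mono) auto
    also have "\<dots> = L\<^sup>2 - (L - 2 * k * t)\<^sup>2" by (simp add: power2_eq_square algebra_simps)
    finally have "4 * k * (\<epsilon> * \<rho>) \<le> L\<^sup>2 - (L - 2 * k * t)\<^sup>2" .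
    then show False using k2 zero_le_power2[of "L - 2 * k * t"] by linarith
  qed
  have xy: "dist x y < \<rho>" using \<open>r < \<rho>\<close> by (simp add: r_def dist_norm norm_minus_commute)
  moreover have "dist y z < \<rho>" using \<open>t < \<rho>\<close> by (simp add: t_def dist_norm norm_minus_commute)
  ultimately have xz: "dist x z < 2 * \<rho>" using dist_triangle[of x z y] by linarith

  \<comment> \<open>\<open>u\<close> and \<open>w\<close> are the negative partial gradients at
    \<open>(z, y)\<close> of the linear and quadratic terms of \<open>h\<close>. The penalty parts
    cancel in \<open>u + w\<close>, leaving \<open>v - (2 * c) *\<^sub>R (y - x)\<close>.\<close>
  define u where "u = (2 * k) *\<^sub>R (y - z)"
  define c where "c = 2 * \<epsilon> / \<rho>"
  define w where "w = v - (2 * c) *\<^sub>R (y - x) - (2 * k) *\<^sub>R (y - z)"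
  \<comment> \<open>Exact expansion of a square about \<open>o'\<close>; the last term becomes the
    error allowed by \<open>frechet_subdiff_quadraticI\<close>.\<close>
  have sq: "(norm (q - s))\<^sup>2 = (norm (o' - s))\<^sup>2 + 2 * ((o' - s) \<bullet> (q - o')) + (norm (q - o'))\<^sup>2"
    for q o' s :: 'a
    by (simp add: power2_norm_eq_inner inner_diff inner_commute)
  have "u \<in> frechet_subdiff F z"
  proof (rule frechet_subdiff_quadraticI[of F, OF f[OF zU], where c = k])
    show "2 * \<rho> - dist x z > 0" using xz by simp
    fix q assume "q \<in> ball z (2 * \<rho> - dist x z)"
    then have "q \<in> cball x (2 * \<rho>)" using dist_triangle[of x q z] by auto
    then have "\<Psi> p \<le> \<Psi> (q, y)" and qU: "q \<in> U" using p(2)[of "(q, y)"] y KU by (auto simp: K_def)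
    then have "f z + k * (norm (z - y))\<^sup>2 \<le> f q + k * (norm (q - y))\<^sup>2"
      by (simp add: \<Psi>_def h_def zy b)
    moreover have "u \<bullet> (q - z) = k * (- (2 * ((z - y) \<bullet> (q - z))))"
      by (simp add: u_def inner_diff algebra_simps)
    ultimately have "f z + u \<bullet> (q - z) - k * (norm (q - z))\<^sup>2 \<le> f q"
      unfolding sq[where q = q and s = y and o' = z] by (simp add: algebra_simps)
    then show "ereal (f z + u \<bullet> (q - z) - k * (norm (q - z))\<^sup>2) \<le> F q"
      using f[OF qU] by simp
  qed
  moreover have "w \<in> frechet_subdiff \<phi> y"
  proof (rule frechet_subdiff_quadraticI[of \<phi>, OF b, where c = "c + k"])
    show "\<rho> - dist x y > 0" using xy by simp
    fix q assume "q \<in> ball y (\<rho> - dist x y)"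
    then have "q \<in> cball x \<rho>" using dist_triangle[of x q y] by auto
    then have le: "\<Psi> p \<le> \<Psi> (z, q)" using p(2)[of "(z, q)"] z by (auto simp: K_def)
    show "ereal (b + w \<bullet> (q - y) - (c + k) * (norm (q - y))\<^sup>2) \<le> \<phi> q"
    proof (cases "\<phi> q")
      case (real b')
      have "b - v \<bullet> (y - x) + c * (norm (y - x))\<^sup>2 + k * (norm (y - z))\<^sup>2
        \<le> b' - v \<bullet> (q - x) + c * (norm (q - x))\<^sup>2 + k * (norm (q - z))\<^sup>2"
        using le by (simp add: \<Psi>_def h_def zy b real c_def norm_minus_commute)
      moreover have "w \<bullet> (q - y) = v \<bullet> (q - x) - v \<bullet> (y - x)
          - c * (2 * ((y - x) \<bullet> (q - y))) - k * (2 * ((y - z) \<bullet> (q - y)))"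
        by (simp add: w_def inner_diff algebra_simps)
      ultimately have "b + w \<bullet> (q - y) - (c + k) * (norm (q - y))\<^sup>2 \<le> b'"
        unfolding sq[where q = q and s = x and o' = y] sq[where q = q and s = z and o' = y]
        by (simp add: algebra_simps)
      then show ?thesis by (simp add: real)
    qed (use noninf in auto)
  qed
  moreover have "norm (u + w - v) < e"
  proof -
    have "u + w - v = - ((4 * \<epsilon> / \<rho>) *\<^sub>R (y - x))" by (simp add: u_def w_def c_def)
    then have "norm (u + w - v) = 4 * \<epsilon> / \<rho> * r"
      using \<open>\<epsilon> > 0\<close> \<rho>(1) by (simp add: r_def)
    also have "\<dots> \<le> 4 * \<epsilon> / \<rho> * \<rho>" using rt \<open>\<epsilon> > 0\<close> \<rho>(1) by (intro mult_left_mono) auto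
    also have "\<dots> < e" using \<rho>(1) \<open>e > 0\<close> by (simp add: \<epsilon>_def)
    finally show ?thesis .
  qed
  ultimately show thesis using xy xz \<rho> that[of u z w y] by auto
qed

text \<open>The convergence of function values demanded by \<open>limiting_subdiff\<close> comes
  from the continuity of \<open>F\<close> at \<open>x\<close>.\<close>

lemma limiting_subdiffI_lipschitz:
  assumes F: "locally_lipschitz_at F x" and z: "z \<longlonglongrightarrow> x"
    and u: "\<And>n. u n \<in> frechet_subdiff F (z n)" and l: "u \<longlonglongrightarrow> l"
  shows "l \<in> limiting_subdiff F x"
proof -
  obtain U L where U: "open U" "x \<in> U" and fin: "\<forall>y\<in>U. \<bar>F y\<bar> \<noteq> \<infinity>"
    and lip: "L-lipschitz_on U (\<lambda>y. real_of_ereal (F y))"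
    using F unfolding locally_lipschitz_at_def by blast
  have "isCont (\<lambda>y. real_of_ereal (F y)) x"
    using lipschitz_on_continuous_on[OF lip] U continuous_on_eq_continuous_at by blast
  then have "(\<lambda>n. ereal (real_of_ereal (F (z n)))) \<longlonglongrightarrow> ereal (real_of_ereal (F x))"
    using isCont_tendsto_compose[OF _ z] by simp
  moreover have "\<forall>\<^sub>F n in sequentially. ereal (real_of_ereal (F (z n))) = F (z n)"
    using topological_tendstoD[OF z U] by eventually_elim (use fin in \<open>simp add: ereal_real\<close>)
  moreover have "ereal (real_of_ereal (F x)) = F x" using fin U(2) by (simp add: ereal_real)
  ultimately have "(\<lambda>n. F (z n)) \<longlonglongrightarrow> F x" by (metis (mono_tags) Lim_transform_eventually)
  moreover have "x \<in> edom F" using fin U(2) by (force simp: edom_def)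
  ultimately show ?thesis unfolding limiting_subdiff_def using z u l by auto
qed

text \<open>The fuzzy sum rule is applied with tolerances tending to 0. The subgradients of
  \<open>F\<close> are bounded by \<open>L\<close>, so a subsequence converges, and those of
  \<open>\<phi>\<close> converge with it. As the fuzzy rule does not control the values
  \<open>\<phi> (y n)\<close>, outer semicontinuity places the second limit in the subdifferential
  at \<open>x\<close>.\<close>

lemma limiting_subdiff_sum_rule:
  fixes F \<phi> :: "'a::euclidean_space \<Rightarrow> ereal"
  assumes lsc: "lsc_fun \<phi>" and noninf: "\<And>y. \<phi> y \<noteq> -\<infinity>" and dom: "x \<in> edom \<phi>"
    and F: "locally_lipschitz_at F x"
    and osc: "outer_semicontinuous_at (limiting_subdiff \<phi>) x"
    and v: "v \<in> frechet_subdiff (\<lambda>y. F y + \<phi> y) x"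
  obtains u where "u \<in> limiting_subdiff F x" "v - u \<in> limiting_subdiff \<phi> x"
proof -
  obtain U L where U: "open U" "x \<in> U" and fin: "\<forall>y\<in>U. \<bar>F y\<bar> \<noteq> \<infinity>"
    and lip: "L-lipschitz_on U (\<lambda>y. real_of_ereal (F y))"
    using F unfolding locally_lipschitz_at_def by blast
  obtain d where d: "d > 0" "ball x d \<subseteq> U" using U open_contains_ball by blast
  \<comment> \<open>The cap \<open>d\<close> keeps every \<open>z n\<close> in \<open>U\<close>,
    where the bound \<open>L\<close> applies.\<close>
  define e where "e = (\<lambda>n::nat. min d (inverse (real (Suc n))))"
  have e: "e n > 0" "e n \<le> d" "e n \<le> inverse (real (Suc n))" for n using d by (auto simp: e_def)
  have e0: "e \<longlonglongrightarrow> 0"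
    by (rule tendsto_sandwich[OF _ _ tendsto_const LIMSEQ_inverse_real_of_nat])
       (use e in \<open>auto intro!: always_eventually less_imp_le\<close>)
  have "\<exists>z y u w. u \<in> frechet_subdiff F z \<and> w \<in> frechet_subdiff \<phi> y \<and>
    dist x z < e n \<and> dist x y < e n \<and> norm (u + w - v) < e n" for n
    using fuzzy_sum_rule[OF lsc noninf dom F v e(1)[of n]] by metis
  then obtain z y u w where u: "\<And>n. u n \<in> frechet_subdiff F (z n)"
    and w: "\<And>n. w n \<in> frechet_subdiff \<phi> (y n)"
    and close: "\<And>n. dist x (z n) < e n" "\<And>n. dist x (y n) < e n" "\<And>n. norm (u n + w n - v) < e n"
    by metis
  have lim: "s \<longlonglongrightarrow> x" if "\<And>n. dist x (s n) < e n" for s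
    unfolding tendsto_dist_iff[of s]
    by (rule Lim_null_comparison[OF _ e0])
       (use that in \<open>auto simp: dist_commute intro!: always_eventually less_imp_le\<close>)
  have zx: "z \<longlonglongrightarrow> x" and yx: "y \<longlonglongrightarrow> x" using lim close(1,2) by auto
  have uwv: "(\<lambda>n. u n + w n - v) \<longlonglongrightarrow> 0"
    by (rule Lim_null_comparison[OF _ e0]) (use close in \<open>auto intro!: always_eventually less_imp_le\<close>)
  have zU: "z n \<in> U" for n using close(1)[of n] e(2)[of n] d(2) by auto
  have "norm (u n) \<le> L" for n by (rule frechet_subdiff_lipschitz_bound[OF U(1) zU fin lip u])
  then have "bounded (range u)" by (auto simp: bounded_iff)
  then obtain l r where l: "strict_mono r" "(u \<circ> r) \<longlonglongrightarrow> l"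
    using bounded_imp_convergent_subsequence by blast
  have zr: "(\<lambda>n. z (r n)) \<longlonglongrightarrow> x" using LIMSEQ_subseq_LIMSEQ[OF zx l(1)] by (simp add: o_def)
  have "l \<in> limiting_subdiff F x"
    by (rule limiting_subdiffI_lipschitz[OF F zr _ l(2)[unfolded o_def]]) (rule u)
  moreover have "v - l \<in> limiting_subdiff \<phi> x"
  proof -
    have "(\<lambda>n. (u (r n) + w (r n) - v) + v - u (r n)) \<longlonglongrightarrow> 0 + v - l"
      using LIMSEQ_subseq_LIMSEQ[OF uwv l(1)] l(2) by (intro tendsto_intros) (simp_all add: o_def)
    then have "(\<lambda>n. w (r n)) \<longlonglongrightarrow> v - l" by simp
    moreover have "w n \<in> limiting_subdiff \<phi> (y n)" for n using w frechet_subset_limiting by blast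
    ultimately have "v - l \<in> set_Limsup (\<lambda>n. limiting_subdiff \<phi> (y n))"
      unfolding set_Limsup_def using l(1)
      by (intro CollectI exI[of _ r] exI[of _ "\<lambda>n. w (r n)"]) auto
    then show ?thesis using osc yx unfolding outer_semicontinuous_at_def by blast
  qed
  ultimately show thesis using that by blast
qed

section \<open>Prox-regularity and fixed points of the proximal map\<close>

text \<open>The defining inequality is used at the pair \<open>(x, v)\<close> itself, which meets
  the strict level condition because \<open>\<psi> x\<close> is finite.\<close>

lemma prox_regular_lower_bound:
  fixes \<psi> :: "'a::real_inner \<Rightarrow> ereal"
  assumes "prox_regular_at_for \<psi> x v" "\<psi> x = ereal a"
  obtains d \<eta> where "d > 0" "\<eta> \<ge> 0"
    "\<And>y. y \<in> ball x d \<Longrightarrow> ereal (a + v \<bullet> (y - x) - \<eta> / 2 * (norm (y - x))\<^sup>2) \<le> \<psi> y"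
proof -
  obtain d \<eta> where d: "d > 0" "\<eta> \<ge> 0" and v: "v \<in> limiting_subdiff \<psi> x" and
    *: "\<forall>x' \<in> ball x d. \<forall>w \<in> limiting_subdiff \<psi> x' \<inter> ball v d. \<psi> x' < \<psi> x + ereal d \<longrightarrow>
        (\<forall>y \<in> ball x d. \<psi> x' + ereal (w \<bullet> (y - x') - \<eta> / 2 * (norm (y - x'))\<^sup>2) \<le> \<psi> y)"
    using assms(1) unfolding prox_regular_at_for_def by blast
  have "\<psi> x < \<psi> x + ereal d" using d(1) assms(2) by simp
  then have "ereal (a + v \<bullet> (y - x) - \<eta> / 2 * (norm (y - x))\<^sup>2) \<le> \<psi> y" if "y \<in> ball x d" for y
    using *[rule_format, of x v y] d(1) v that assms(2) by (simp add: add_diff_eq)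
  then show thesis using that d by blast
qed

text \<open>
  Near \<open>x\<close> the quadratic minorant absorbs the prox term; away from \<open>x\<close> the prox term
  dominates the at most quadratic decay allowed by prox-boundedness.
\<close>

lemma prox_fixed_point:
  fixes \<phi> :: "'a::real_inner \<Rightarrow> ereal"
  assumes x: "\<phi> x = ereal a" and "d > 0" "\<eta> \<ge> 0" "\<gamma>0 > 0"
    and near: "\<And>y. y \<in> ball x d \<Longrightarrow> ereal (a + v \<bullet> (y - x) - \<eta> / 2 * (norm (y - x))\<^sup>2) \<le> \<phi> y"
    and far: "\<And>y. ereal c \<le> \<phi> y + ereal (1 / (2 * \<gamma>0) * (norm y)\<^sup>2)"
  obtains \<gamma> where "0 < \<gamma>" "\<gamma> \<le> \<gamma>0" "x \<in> prox \<gamma> \<phi> (x + \<gamma> *\<^sub>R v)"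
proof -
  define B where "B = \<bar>a - c\<bar> + 1 / \<gamma>0 * (norm x)\<^sup>2"
  \<comment> \<open>\<open>M\<close> adds up the quadratic rates required: \<open>\<eta> / 2\<close>
    near \<open>x\<close>, and at distance \<open>s \<ge> d\<close> those absorbing the growth of
    \<open>(norm y)\<^sup>2\<close>, the linear term in \<open>v\<close> and the constant
    \<open>B\<close>; the last two use \<open>s / d \<ge> 1\<close>.\<close>
  define M where "M = \<eta> / 2 + 1 / \<gamma>0 + norm v / d + B / d\<^sup>2"
  define \<gamma> where "\<gamma> = 1 / (2 * M)"
  have B: "B \<ge> 0" using assms by (simp add: B_def)
  have M: "M \<ge> 1 / \<gamma>0" "M \<ge> \<eta> / 2" "M > 0" using assms B by (auto simp: M_def add_nonneg_pos add_pos_nonneg)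
  have "\<gamma> > 0" using M by (simp add: \<gamma>_def)
  moreover have "\<gamma> \<le> \<gamma>0"
  proof -
    have "1 \<le> M * \<gamma>0" using M(1) assms(4) by (simp add: field_simps)
    then have "1 \<le> 2 * (M * \<gamma>0)" by linarith
    then show ?thesis using M(3) by (simp add: \<gamma>_def field_simps)
  qed
  moreover have "x \<in> prox \<gamma> \<phi> (x + \<gamma> *\<^sub>R v)"
  proof -
    \<comment> \<open>Since \<open>M = 1 / (2 * \<gamma>)\<close>, expanding the square about the
      centre \<open>x + \<gamma> *\<^sub>R v\<close> shows that this global minorant is the
      minimality of \<open>x\<close>.\<close>
    have lower: "ereal (a + v \<bullet> (y - x) - M * (norm (y - x))\<^sup>2) \<le> \<phi> y" for y
    proof (cases "y \<in> ball x d")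
      case True
      have "a + v \<bullet> (y - x) - M * (norm (y - x))\<^sup>2 \<le> a + v \<bullet> (y - x) - \<eta> / 2 * (norm (y - x))\<^sup>2"
        using mult_right_mono[OF M(2), of "(norm (y - x))\<^sup>2"] by simp
      then show ?thesis using near[OF True] order_trans ereal_less_eq(3) by blast
    next
      case False
      define s where "s = norm (y - x)"
      have s: "s \<ge> d" using False by (simp add: s_def dist_norm norm_minus_commute)
      have "\<phi> y \<noteq> -\<infinity>" using far[of y] by auto
      then show ?thesis
      proof (cases "\<phi> y")
        case (real b)
        have "norm y \<le> s + norm x" using norm_triangle_ineq[of "y - x" x] by (simp add: s_def)
        then have "(norm y)\<^sup>2 \<le> (s + norm x)\<^sup>2" by (intro power_mono) auto
        \<comment> \<open>The factor 2 here is why \<open>M\<close> and \<open>B\<close> carry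
          \<open>1 / \<gamma>0\<close> and not \<open>1 / (2 * \<gamma>0)\<close>.\<close>
        also have "\<dots> \<le> 2 * s\<^sup>2 + 2 * (norm x)\<^sup>2"
          using zero_le_power2[of "s - norm x"] by (simp add: power2_eq_square algebra_simps)
        finally have "1 / (2 * \<gamma>0) * (norm y)\<^sup>2 \<le> 1 / (2 * \<gamma>0) * (2 * s\<^sup>2 + 2 * (norm x)\<^sup>2)"
          using assms(4) by (intro mult_left_mono) auto
        also have "\<dots> = 1 / \<gamma>0 * s\<^sup>2 + 1 / \<gamma>0 * (norm x)\<^sup>2"
          using assms(4) by (simp add: field_simps)
        finally have 1: "c - 1 / \<gamma>0 * s\<^sup>2 - 1 / \<gamma>0 * (norm x)\<^sup>2 \<le> b"
          using far[of y] real by simp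
        have 2: "v \<bullet> (y - x) \<le> norm v / d * s\<^sup>2"
        proof -
          have "v \<bullet> (y - x) \<le> norm v * s" unfolding s_def by (rule norm_cauchy_schwarz)
          also have "\<dots> \<le> norm v * (s * (s / d))"
            using s \<open>d > 0\<close> by (intro mult_left_mono) (auto simp: field_simps)
          finally show ?thesis by (simp add: power2_eq_square)
        qed
        have 3: "B \<le> B / d\<^sup>2 * s\<^sup>2"
        proof -
          have "B * d\<^sup>2 \<le> B * s\<^sup>2" using s B \<open>d > 0\<close> by (intro mult_left_mono power_mono) auto
          then show ?thesis using \<open>d > 0\<close> by (simp add: field_simps)
        qed
        have 4: "M * s\<^sup>2 = \<eta> / 2 * s\<^sup>2 + 1 / \<gamma>0 * s\<^sup>2 + norm v / d * s\<^sup>2 + B / d\<^sup>2 * s\<^sup>2"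
          by (simp only: M_def distrib_right)
        have 5: "\<eta> / 2 * s\<^sup>2 \<ge> 0" using \<open>\<eta> \<ge> 0\<close> by simp
        have "a + v \<bullet> (y - x) - M * s\<^sup>2 \<le> b"
          using 1 2 3 4 5 abs_ge_self[of "a - c"] unfolding B_def by linarith
        then show ?thesis using real by (simp add: s_def)
      qed auto
    qed
    have half: "1 / (2 * \<gamma>) = M" using M(3) by (simp add: \<gamma>_def)
    have "\<phi> x + ereal (M * (norm (x - (x + \<gamma> *\<^sub>R v)))\<^sup>2) \<le> \<phi> y + ereal (M * (norm (y - (x + \<gamma> *\<^sub>R v)))\<^sup>2)" for y
    proof -
      have "(norm (y - (x + \<gamma> *\<^sub>R v)))\<^sup>2 = (norm (y - x))\<^sup>2 - 2 * \<gamma> * (v \<bullet> (y - x)) + (norm (\<gamma> *\<^sub>R v))\<^sup>2"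
        unfolding power2_norm_eq_inner by (simp add: inner_diff inner_add inner_commute algebra_simps)
      then have "M * (norm (y - (x + \<gamma> *\<^sub>R v)))\<^sup>2
          = M * (norm (y - x))\<^sup>2 - (2 * M * \<gamma>) * (v \<bullet> (y - x)) + M * (norm (\<gamma> *\<^sub>R v))\<^sup>2"
        by (simp only: distrib_left right_diff_distrib mult.assoc mult.left_commute[of M 2])
      also have "2 * M * \<gamma> = 1" using M(3) by (simp add: \<gamma>_def)
      finally have id: "M * (norm (y - (x + \<gamma> *\<^sub>R v)))\<^sup>2
          = M * (norm (y - x))\<^sup>2 - v \<bullet> (y - x) + M * (norm (\<gamma> *\<^sub>R v))\<^sup>2" by simp
      have "norm (x - (x + \<gamma> *\<^sub>R v)) = norm (\<gamma> *\<^sub>R v)" by simp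
      then have "\<phi> x + ereal (M * (norm (x - (x + \<gamma> *\<^sub>R v)))\<^sup>2)
         = ereal (a + v \<bullet> (y - x) - M * (norm (y - x))\<^sup>2) + ereal (M * (norm (y - (x + \<gamma> *\<^sub>R v)))\<^sup>2)"
        unfolding id by (simp add: x)
      also have "\<dots> \<le> \<phi> y + ereal (M * (norm (y - (x + \<gamma> *\<^sub>R v)))\<^sup>2)"
        by (intro add_right_mono lower)
      finally show ?thesis .
    qed
    then show ?thesis by (simp add: prox_def is_arg_min_def half not_less)
  qed
  ultimately show thesis using that by blast
qed

section \<open>The residual measure and the equivalence\<close>

text \<open>Yields concrete \<open>v\<close> and \<open>p\<close> without the infimum having to be
  attained.\<close>

lemma residual_measure_less_iff:
  "residual_measure \<gamma> F \<phi> x < c \<longleftrightarrow>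
    (\<exists>v\<in>limiting_subdiff F x. \<exists>p\<in>prox \<gamma> \<phi> (x - \<gamma> *\<^sub>R v). ereal (norm ((x - p) /\<^sub>R \<gamma>)) < c)"
  unfolding residual_measure_def Inf_less_iff by blast

lemma residual_measure_nonneg: "0 \<le> residual_measure \<gamma> F \<phi> x"
  unfolding residual_measure_def by (rule Inf_greatest) auto

theorem theorem3p15:
  fixes F \<phi> :: "'a::euclidean_space \<Rightarrow> ereal"
    and \<gamma>\<phi> :: ereal and \<gamma>tilde :: real and xstar :: 'a
  assumes "proper_fun F" and "lsc_fun F"
    and "proper_fun \<phi>" and "lsc_fun \<phi>"
    and "(INF x. F x + \<phi> x) > -\<infinity>"
    and "\<forall>x \<in> interior (edom F). locally_lipschitz_at F x"
    and "convex (edom F)"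
    and "edom \<phi> \<subseteq> interior (edom F)"
    and "prox_bounded_with_threshold \<phi> \<gamma>\<phi>"
    and "\<forall>x \<in> interior (edom F). lower_regular_at F x"
    and "\<forall>x \<in> edom \<phi>. prox_regular_at \<phi> x"
    and "\<forall>x \<in> edom \<phi>. outer_semicontinuous_at (limiting_subdiff \<phi>) x"
    and "0 < \<gamma>tilde" and "ereal \<gamma>tilde < \<gamma>\<phi>"
    and "xstar \<in> edom \<phi>"
  shows "frechet_stationary F \<phi> xstar \<longleftrightarrow>
    (\<exists>(x :: nat \<Rightarrow> 'a) (\<gamma> :: nat \<Rightarrow> real).
        (\<forall>n. x n \<in> interior (edom F)) \<and> x \<longlonglongrightarrow> xstar \<and>
        (\<forall>n. \<gamma> n \<in> {0<..\<gamma>tilde}) \<and>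
        liminf (\<lambda>n. residual_measure (\<gamma> n) F \<phi> (x n)) = 0)"
    (is "?stat \<longleftrightarrow> ?seq")
proof -
  have noninf: "\<phi> y \<noteq> -\<infinity>" for y using assms(3) by (simp add: proper_fun_def)
  obtain a where a: "\<phi> xstar = ereal a"
    using assms(15) noninf[of xstar] by (cases "\<phi> xstar") (auto simp: edom_def)
  have int: "xstar \<in> interior (edom F)" using assms(8,15) by blast
  have osc: "outer_semicontinuous_at (limiting_subdiff \<phi>) xstar" using assms(12,15) by blast
  have lipat: "locally_lipschitz_at F xstar" using assms(6) int by blast
  have prox_reg: "prox_regular_at_for \<phi> xstar v" if "v \<in> limiting_subdiff \<phi> xstar" for v
    using assms(11,15) that by (auto simp: prox_regular_at_def)
  show ?thesis
  proof
    assume ?stat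
    \<comment> \<open>The sum rule is used for the subgradient 0, hence the form
      \<open>0 - u\<close>.\<close>
    then obtain u where u: "u \<in> limiting_subdiff F xstar" "0 - u \<in> limiting_subdiff \<phi> xstar"
      using limiting_subdiff_sum_rule[OF assms(4) noninf assms(15) lipat osc]
      unfolding frechet_stationary_def by blast
    obtain d \<eta> where d: "d > 0" "\<eta> \<ge> 0"
      "\<And>y. y \<in> ball xstar d \<Longrightarrow> ereal (a + (0 - u) \<bullet> (y - xstar) - \<eta> / 2 * (norm (y - xstar))\<^sup>2) \<le> \<phi> y"
      using prox_regular_lower_bound[OF prox_reg[OF u(2)] a] by blast
    \<comment> \<open>Prox-boundedness is taken at \<open>\<gamma>tilde\<close> itself, so that the
      step size found next is at most \<open>\<gamma>tilde\<close>.\<close>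
    obtain c where "\<And>y. ereal c \<le> \<phi> y + ereal (1 / (2 * \<gamma>tilde) * (norm y)\<^sup>2)"
      using assms(9,13,14) unfolding prox_bounded_with_threshold_def by blast
    then obtain \<gamma> where \<gamma>: "0 < \<gamma>" "\<gamma> \<le> \<gamma>tilde" "xstar \<in> prox \<gamma> \<phi> (xstar + \<gamma> *\<^sub>R (0 - u))"
      using prox_fixed_point[of \<phi>, OF a d(1,2) assms(13) d(3)] by blast
    then have "xstar \<in> prox \<gamma> \<phi> (xstar - \<gamma> *\<^sub>R u)" by simp
    then have "residual_measure \<gamma> F \<phi> xstar \<le> ereal (norm ((xstar - xstar) /\<^sub>R \<gamma>))"
      unfolding residual_measure_def using u(1) by (intro Inf_lower) blast
    then have "residual_measure \<gamma> F \<phi> xstar = 0"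
      using residual_measure_nonneg[of \<gamma> F \<phi> xstar] by (simp add: zero_ereal_def)
    then show ?seq using int \<gamma>
      by (intro exI[of _ "\<lambda>_. xstar"] exI[of _ "\<lambda>_. \<gamma>"]) (simp add: Liminf_const)
  next
    assume ?seq
    then obtain x \<gamma> where xint: "\<And>n. x n \<in> interior (edom F)" and xlim: "x \<longlonglongrightarrow> xstar"
      and \<gamma>: "\<And>n. 0 < \<gamma> n" "\<And>n. \<gamma> n \<le> \<gamma>tilde"
      and lim0: "liminf (\<lambda>n. residual_measure (\<gamma> n) F \<phi> (x n)) = 0" by auto
    obtain U L where U: "open U" "xstar \<in> U" and fin: "\<forall>y\<in>U. \<bar>F y\<bar> \<noteq> \<infinity>"
      and lip: "L-lipschitz_on U (\<lambda>y. real_of_ereal (F y))"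
      using lipat unfolding locally_lipschitz_at_def by blast
    have evU: "\<forall>\<^sub>F n in sequentially. x n \<in> U" using topological_tendstoD[OF xlim U] .
    \<comment> \<open>Otherwise a tail of the residuals would stay above a positive number, against
      the zero lower limit. The indices chosen need not increase: \<open>N k \<ge> k\<close>
      suffices for \<open>x (N k)\<close> to converge.\<close>
    have "\<exists>n\<ge>k. x n \<in> U \<and> residual_measure (\<gamma> n) F \<phi> (x n) < ereal (inverse (real (Suc k)))" for k
    proof (rule ccontr)
      assume "\<not> ?thesis"
      then have "\<forall>\<^sub>F n in sequentially. ereal (inverse (real (Suc k))) \<le> residual_measure (\<gamma> n) F \<phi> (x n)"
        by (intro eventually_mono[OF eventually_conj[OF evU eventually_ge_at_top[of k]]]) (auto simp: not_less)
      then have "ereal (inverse (real (Suc k))) \<le> 0" using Liminf_bounded lim0 by metis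
      then show False by simp
    qed
    then obtain N where N: "\<And>k. N k \<ge> k" "\<And>k. x (N k) \<in> U"
      "\<And>k. residual_measure (\<gamma> (N k)) F \<phi> (x (N k)) < ereal (inverse (real (Suc k)))" by metis
    have "\<exists>v p. v \<in> limiting_subdiff F (x (N k)) \<and> p \<in> prox (\<gamma> (N k)) \<phi> (x (N k) - \<gamma> (N k) *\<^sub>R v) \<and>
      norm ((x (N k) - p) /\<^sub>R \<gamma> (N k)) < inverse (real (Suc k))" for k
      using N(3)[of k] unfolding residual_measure_less_iff ereal_less(1) by auto
    then obtain v p where v: "\<And>k. v k \<in> limiting_subdiff F (x (N k))"
      and p: "\<And>k. p k \<in> prox (\<gamma> (N k)) \<phi> (x (N k) - \<gamma> (N k) *\<^sub>R v k)"
      and small: "\<And>k. norm ((x (N k) - p k) /\<^sub>R \<gamma> (N k)) < inverse (real (Suc k))" by metis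
    define g where "g = (\<lambda>k. (x (N k) - p k) /\<^sub>R \<gamma> (N k))"
    have xN: "(\<lambda>k. x (N k)) \<longlonglongrightarrow> xstar"
      using filterlim_compose[OF xlim filterlim_at_top_mono[OF filterlim_ident]] N(1)
      by (metis always_eventually)
    have g0: "g \<longlonglongrightarrow> 0"
      by (rule Lim_null_comparison[OF _ LIMSEQ_inverse_real_of_nat])
         (use small in \<open>auto simp: g_def intro!: always_eventually less_imp_le\<close>)
    have pg: "p k = x (N k) - \<gamma> (N k) *\<^sub>R g k" for k using \<gamma>(1)[of "N k"] by (simp add: g_def)
    \<comment> \<open>The step sizes need not tend to 0; their bound \<open>\<gamma>tilde\<close>
      already makes \<open>p\<close> follow \<open>x\<close>.\<close>
    have "(\<lambda>k. \<gamma> (N k) *\<^sub>R g k) \<longlonglongrightarrow> 0"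
    proof (rule Lim_null_comparison)
      show "\<forall>\<^sub>F k in sequentially. norm (\<gamma> (N k) *\<^sub>R g k) \<le> \<gamma>tilde * norm (g k)"
        using \<gamma> by (auto intro!: always_eventually mult_right_mono simp: abs_of_pos)
      show "(\<lambda>k. \<gamma>tilde * norm (g k)) \<longlonglongrightarrow> 0"
        using tendsto_mult_right_zero[OF tendsto_norm_zero[OF g0]] .
    qed
    from tendsto_diff[OF xN this] have plim: "p \<longlonglongrightarrow> xstar" by (simp add: pg[abs_def])
    \<comment> \<open>Lower regularity makes each \<open>v k\<close> a Frechet subgradient, the kind
      to which the Lipschitz bound applies.\<close>
    have vF: "v k \<in> frechet_subdiff F (x (N k))" for k
      using v assms(10) xint unfolding lower_regular_at_def by blast
    have "norm (v k) \<le> L" for k by (rule frechet_subdiff_lipschitz_bound[OF U(1) N(2) fin lip vF])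
    then have "bounded (range v)" by (auto simp: bounded_iff)
    then obtain l r where l: "strict_mono r" "(v \<circ> r) \<longlonglongrightarrow> l"
      using bounded_imp_convergent_subsequence by blast
    have xr: "(\<lambda>k. x (N (r k))) \<longlonglongrightarrow> xstar" using LIMSEQ_subseq_LIMSEQ[OF xN l(1)] by (simp add: o_def)
    have "l \<in> limiting_subdiff F xstar"
      by (rule limiting_subdiffI_lipschitz[OF lipat xr _ l(2)[unfolded o_def]]) (rule vF)
    then have lF: "l \<in> frechet_subdiff F xstar"
      using assms(10) int unfolding lower_regular_at_def by blast
    have "g k - v k \<in> limiting_subdiff \<phi> (p k)" for k
    proof -
      \<comment> \<open>The prox centre is shifted by the gradient step, so the optimality quotient
        splits into the residual \<open>g k\<close> and a subgradient of \<open>F\<close>.\<close>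
      have "(x (N k) - \<gamma> (N k) *\<^sub>R v k - p k) /\<^sub>R \<gamma> (N k) = g k - v k"
        using \<gamma>(1)[of "N k"] by (simp add: g_def algebra_simps)
      then show ?thesis
        using prox_optimality[OF assms(3) \<gamma>(1) p] frechet_subset_limiting by (metis subsetD)
    qed
    moreover have "(\<lambda>k. g (r k) - v (r k)) \<longlonglongrightarrow> 0 - l"
      using LIMSEQ_subseq_LIMSEQ[OF g0 l(1)] l(2) by (intro tendsto_intros) (simp_all add: o_def)
    ultimately have "- l \<in> set_Limsup (\<lambda>k. limiting_subdiff \<phi> (p k))"
      unfolding set_Limsup_def using l(1) by force
    then have "- l \<in> limiting_subdiff \<phi> xstar"
      using osc plim unfolding outer_semicontinuous_at_def by blast
    \<comment> \<open>The quadratic minorant from prox-regularity upgrades \<open>- l\<close> from a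
      limiting to a Frechet subgradient, as the addition of Frechet subgradients requires.\<close>
    then obtain d \<eta> where "d > 0" and
      "\<And>y. y \<in> ball xstar d \<Longrightarrow> ereal (a + (- l) \<bullet> (y - xstar) - \<eta> / 2 * (norm (y - xstar))\<^sup>2) \<le> \<phi> y"
      using prox_regular_lower_bound[OF prox_reg a] by blast
    then have "- l \<in> frechet_subdiff \<phi> xstar" by (intro frechet_subdiff_quadraticI[of \<phi>, OF a])
    moreover have "F xstar = ereal (real_of_ereal (F xstar))" using fin U(2) by (simp add: ereal_real)
    ultimately have "l + - l \<in> frechet_subdiff (\<lambda>y. F y + \<phi> y) xstar"
      using frechet_subdiff_add[where \<psi> = F and \<theta> = \<phi>, OF _ a lF] by blast
    then show ?stat using assms(15) by (simp add: frechet_stationary_def)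
  qed
qed

end
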